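(* For $n\ge 0$ let $$A_n(x)=\frac{1}{n!}\sum_{k=1}^{n}\binom{n}{k}\left(H_n-H_{n-k}\right)x^{k-1}\in\mathbb{Q}[x],$$ where $H_m=\sum_{i=1}^m 1/i$ ($H_0=0$). Let $\alpha_n$ be the least common multiple of the denominators of the coefficients of $A_n(x)$, each coefficient written in lowest terms. Then for every $n\ge 1$, $$\alpha_n = n!\,\operatorname{lcm}(1,2,\dots,n).$$
   Context: The polynomial $A_n$ is characterized by $f_n(x)=-xA_n(x)+\frac{(1+x)^n}{n!}\ln(1+x)$, where $f_0(x)=\ln(1+x)$ and $f_n(x)=\int_0^x f_{n-1}(t)\,dt$. *)

theory Defs
  imports "HOL-Computational_Algebra.Computational_Algebra"
begin

(* The library's harm is restricted to real normed fields, hence not available over rat. *)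
definition harmonic :: "nat \<Rightarrow> rat" where
  "harmonic m = (\<Sum>i=1..m. 1 / of_nat i)"

definition A_poly :: "nat \<Rightarrow> rat poly" where
  "A_poly n = smult (1 / fact n)
     (\<Sum>k=1..n. monom (of_nat (n choose k) * (harmonic n - harmonic (n - k))) (k - 1))"

(* quotient_of yields the coprime representation with positive denominator (0 being 0/1). *)
definition denominator :: "rat \<Rightarrow> int" where
  "denominator q = snd (quotient_of q)"

definition coeff_denom_lcm :: "rat poly \<Rightarrow> int" where
  "coeff_denom_lcm p = Lcm ((\<lambda>i. denominator (coeff p i)) ` {..degree p})"

definition alpha :: "nat \<Rightarrow> int" where
  "alpha n = coeff_denom_lcm (A_poly n)"

end

theory Submission
  imports Defs
begin

text \<open>
  The common denominator divides \<open>n! L\<close> with \<open>L = lcm(1,\<dots>,n)\<close> because \<open>L\<close> clears each \<open>1/i\<close>.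
  For the converse, fix a prime \<open>p\<close> and let \<open>q\<close> be the largest power of \<open>p\<close> with \<open>q \<le> n\<close>;
  the coefficient with \<open>k = q\<close> already has the full power of \<open>p\<close> in its denominator.
  Indeed \<open>binomial(n, q)\<close> is congruent to \<open>\<lfloor>n/q\<rfloor>\<close> modulo \<open>p\<close>, hence prime to \<open>p\<close>, and among the
  \<open>q\<close> consecutive integers \<open>n - q < i \<le> n\<close> exactly one is divisible by \<open>q\<close>, so that exactly one
  term of \<open>L (H\<^sub>n - H\<^bsub>n-q\<^esub>) = \<Sum> L/i\<close> is prime to \<open>p\<close>.
\<close>

text \<open>By absorption \<open>p ^ e\<close> divides \<open>j\<close> times the binomial; were the
  latter prime to \<open>p\<close>, all of \<open>p ^ e\<close> would divide the smaller
  \<open>j\<close>.\<close>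

lemma prime_dvd_choose_prime_power:
  fixes p :: nat
  assumes "prime p" "0 < j" "j < p ^ e"
  shows "p dvd (p ^ e choose j)"
proof (rule ccontr)
  assume "\<not> p dvd (p ^ e choose j)"
  then have "coprime (p ^ e) (p ^ e choose j)"
    using assms(1) by (simp add: prime_imp_coprime)
  moreover have "j * (p ^ e choose j) = p ^ e * ((p ^ e - 1) choose (j - 1))"
    using assms by (simp add: times_binomial_minus1_eq)
  then have "p ^ e dvd j * (p ^ e choose j)" by simp
  ultimately have "p ^ e dvd j"
    by (simp add: coprime_dvd_mult_left_iff)
  then show False using assms by (auto dest: dvd_imp_le)
qed

text \<open>In Vandermonde's convolution only the two end terms survive modulo
  \<open>p\<close>.\<close>

lemma choose_add_prime_power_mod:
  fixes p m e :: nat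
  assumes "prime p"
  defines "q \<equiv> p ^ e"
  shows "(m + q choose q) mod p = ((m choose q) + 1) mod p"
proof -
  have "q > 0" unfolding q_def using assms(1) by (simp add: prime_gt_0_nat)
  have "(m + q choose q) = (\<Sum>k\<le>q. (q choose k) * (m choose (q - k)))"
    using vandermonde[of q m q] by (simp add: add.commute)
  also have "{..q} = insert 0 (insert q {0<..<q})" using \<open>q > 0\<close> by auto
  also have "(\<Sum>k\<in>\<dots>. (q choose k) * (m choose (q - k)))
      = (m choose q) + 1 + (\<Sum>k\<in>{0<..<q}. (q choose k) * (m choose (q - k)))"
    using \<open>q > 0\<close> by simp
  finally have eq: "(m + q choose q) = \<dots>" .
  have "p dvd (\<Sum>k\<in>{0<..<q}. (q choose k) * (m choose (q - k)))"
    using prime_dvd_choose_prime_power[OF assms(1)] by (auto intro!: dvd_sum simp: q_def)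
  then obtain t where "(\<Sum>k\<in>{0<..<q}. (q choose k) * (m choose (q - k))) = p * t" ..
  then show ?thesis unfolding eq by simp
qed

text \<open>A case of Lucas's theorem, by descending from \<open>n\<close> in steps of
  \<open>p ^ e\<close>.\<close>

lemma choose_prime_power_mod:
  fixes p n e :: nat
  assumes "prime p"
  shows "(n choose p ^ e) mod p = (n div p ^ e) mod p"
proof (induction n rule: less_induct)
  case (less n)
  have pos: "p ^ e > 0" using assms by (simp add: prime_gt_0_nat)
  show ?case
  proof (cases "n < p ^ e")
    case True
    then show ?thesis by (simp add: binomial_eq_0)
  next
    case False
    then have "n - p ^ e + p ^ e = n" by simp
    then have "(n choose p ^ e) mod p = ((n - p ^ e choose p ^ e) + 1) mod p"
      using choose_add_prime_power_mod[OF assms, of "n - p ^ e" e] by simp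
    also have "\<dots> = ((n - p ^ e) div p ^ e + 1) mod p"
      using False pos by (intro mod_add_cong less.IH refl) linarith
    also have "(n - p ^ e) div p ^ e + 1 = n div p ^ e"
      using False pos by (simp add: le_div_geq)
    finally show ?thesis .
  qed
qed

lemma prime_power_dvd_lcm_iff:
  fixes p a b :: nat
  assumes "prime p" "a > 0" "b > 0"
  shows "p ^ k dvd lcm a b \<longleftrightarrow> p ^ k dvd a \<or> p ^ k dvd b"
proof -
  have "\<not> is_unit p" "a \<noteq> 0" "b \<noteq> 0" "lcm a b \<noteq> 0"
    using assms by (auto simp: lcm_eq_0_iff)
  then show ?thesis
    using assms(1) by (simp add: power_dvd_iff_le_multiplicity multiplicity_lcm le_max_iff_disj)
qed

text \<open>The exponent of \<open>p\<close> in an lcm is the maximum of the exponents. Positivity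
  of \<open>k\<close> excludes the empty set, whose \<open>Lcm\<close> is 1.\<close>

lemma prime_power_dvd_LcmD:
  fixes p :: nat
  assumes "prime p" "k > 0" "finite A" "0 \<notin> A" "p ^ k dvd Lcm A"
  shows "\<exists>a\<in>A. p ^ k dvd a"
  using assms(3-5)
proof (induction A rule: finite_induct)
  case empty
  then show ?case using assms(1,2) by auto
next
  case (insert a A)
  then have "Lcm A \<noteq> 0" by (simp add: Lcm_0_iff)
  with insert show ?case
    using prime_power_dvd_lcm_iff[OF assms(1), of a "Lcm A" k] by auto
qed

text \<open>The sum is \<open>L (H\<^sub>n - H\<^bsub>n-q\<^esub>)\<close>; each division is exact.\<close>

lemma not_dvd_sum_Lcm_div:
  fixes p n e :: nat
  assumes p: "prime p" and e: "p ^ e \<le> n" "n < p ^ Suc e"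
  shows "\<not> p dvd (\<Sum>i\<in>{n - p ^ e<..n}. Lcm {1..n} div i)"
proof -
  define q where "q = p ^ e"
  define L where "L = Lcm {1..n}"
  \<comment> \<open>The unique multiple of \<open>q\<close> in the window from
    \<open>n - q + 1\<close> to \<open>n\<close>.\<close>
  define c where "c = n div q * q"
  have q: "q > 0" "q \<le> n" using p e by (simp_all add: q_def prime_gt_0_nat)
  have cq: "c \<le> n" "n - q < c" unfolding c_def
    using q mod_less_divisor[OF q(1), of n] by (simp_all add: minus_mod_eq_div_mult [symmetric])
  have dvd_L: "i dvd L" if "n - q < i" "i \<le> n" for i
    using that unfolding L_def by (intro dvd_Lcm) auto
  \<comment> \<open>As \<open>q\<close> divides \<open>c\<close>, one more factor \<open>p\<close>
    would make \<open>p ^ Suc e\<close> divide \<open>L\<close>, hence some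
    \<open>i \<le> n\<close>.\<close>
  have "\<not> p dvd L div c"
  proof
    assume "p dvd L div c"
    then have "p * c dvd L" using dvd_L[OF cq(2,1)] cq
      by (metis dvd_div_iff_mult mult.commute gr_implies_not0)
    then have "p ^ Suc e dvd L" unfolding c_def q_def
      by (metis dvd_mult_right mult.assoc mult.commute power_Suc)
    then obtain i where "i \<in> {1..n}" "p ^ Suc e dvd i"
      using prime_power_dvd_LcmD[OF p, of "Suc e" "{1..n}"] unfolding L_def by auto
    then show False using e(2) by (auto dest!: dvd_imp_le)
  qed
  \<comment> \<open>Since \<open>q\<close> divides \<open>L = i * (L div i)\<close>, a cofactor
    prime to \<open>p\<close> would push all of \<open>q\<close> into \<open>i\<close>, forcing
    \<open>i = c\<close>.\<close>
  moreover have "p dvd L div i" if i: "n - q < i" "i \<le> n" "i \<noteq> c" for i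
  proof (rule ccontr)
    assume "\<not> p dvd L div i"
    then have "coprime q (L div i)" using p by (simp add: q_def prime_imp_coprime)
    moreover have "q dvd L" unfolding L_def using q by (intro dvd_Lcm) auto
    then have "q dvd i * (L div i)" using dvd_L[OF i(1,2)] by simp
    ultimately have "q dvd i" by (simp add: coprime_dvd_mult_left_iff)
    then obtain m where m: "i = q * m" by auto
    have "m = n div q"
      using i m q by (intro sym[OF div_nat_eqI]) (auto simp: algebra_simps)
    then show False using i m by (simp add: c_def)
  qed
  then have "p dvd (\<Sum>i\<in>{n - q<..n} - {c}. L div i)" by (intro dvd_sum) auto
  moreover have "(\<Sum>i\<in>{n - q<..n}. L div i) = L div c + (\<Sum>i\<in>{n - q<..n} - {c}. L div i)"
    using cq by (intro sum.remove) auto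
  ultimately show ?thesis unfolding q_def[symmetric] L_def[symmetric]
    by (simp add: dvd_add_left_iff)
qed

text \<open>Coprimality cancels the numerator. This turns divisibility statements about
  \<open>alpha\<close> into integrality of multiples of coefficients.\<close>

lemma denominator_dvd_iff: "denominator r dvd d \<longleftrightarrow> of_int d * r \<in> \<int>"
proof -
  obtain a b where ab: "quotient_of r = (a, b)" by fastforce
  have b: "b > 0" "coprime a b" "r = of_int a / of_int b"
    using quotient_of_denom_pos[OF ab] quotient_of_coprime[OF ab] quotient_of_div[OF ab] by auto
  have "of_int d * r \<in> \<int> \<longleftrightarrow> (\<exists>z. (of_int (d * a) :: rat) = of_int (z * b))"
    using b(1) unfolding Ints_def image_iff b(3) by (simp add: divide_eq_eq)
  also have "\<dots> \<longleftrightarrow> b dvd d * a"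
    by (simp only: of_int_eq_iff) (auto simp: dvd_def mult.commute)
  also have "\<dots> \<longleftrightarrow> b dvd d"
    using b by (simp add: coprime_dvd_mult_left_iff coprime_commute)
  finally show ?thesis by (simp add: denominator_def ab)
qed

lemma coeff_denom_lcm_dvd_iff:
  "coeff_denom_lcm P dvd d \<longleftrightarrow> (\<forall>i. of_int d * coeff P i \<in> \<int>)"
proof -
  have "coeff_denom_lcm P dvd d \<longleftrightarrow> (\<forall>i\<le>degree P. of_int d * coeff P i \<in> \<int>)"
    by (auto simp: coeff_denom_lcm_def Lcm_dvd_iff denominator_dvd_iff)
  then show ?thesis by (metis Ints_0 coeff_eq_0 leI mult_zero_right)
qed

lemma coeff_A_poly:
  "coeff (A_poly n) i =
    (if i < n then of_nat (n choose Suc i) * (harmonic n - harmonic (n - Suc i)) / fact n else 0)"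
proof -
  have "coeff (A_poly n) i = (\<Sum>k=1..n. if k = Suc i
      then of_nat (n choose k) * (harmonic n - harmonic (n - k)) / fact n else 0)"
    unfolding A_poly_def coeff_smult coeff_sum sum_distrib_left by (intro sum.cong) auto
  then show ?thesis by (simp add: sum.delta)
qed

lemma Lcm_mult_harmonic_diff:
  assumes "k \<le> n"
  shows "of_nat (Lcm {1..n}) * (harmonic n - harmonic (n - k))
    = of_nat (\<Sum>i\<in>{n - k<..n}. Lcm {1..n} div i)"
proof -
  have "{1..n} = {1..n - k} \<union> {n - k<..n}" by auto
  then have "harmonic n = harmonic (n - k) + (\<Sum>i\<in>{n - k<..n}. 1 / of_nat i)"
    unfolding harmonic_def by (simp only:) (intro sum.union_disjoint; auto)
  moreover have "of_nat (Lcm {1..n} div i) = (of_nat (Lcm {1..n}) / of_nat i :: rat)"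
    if "i \<in> {n - k<..n}" for i
  proof -
    have "i dvd Lcm {1..n}" using that by (intro dvd_Lcm) auto
    then obtain m where "Lcm {1..n} = i * m" by (rule dvdE)
    then show ?thesis using that by (simp only:) simp
  qed
  ultimately show ?thesis by (simp add: sum_distrib_left)
qed

text \<open>Serves both directions: the right side is an integer for every \<open>k\<close>, and for
  \<open>k = p ^ e\<close> it will be prime to \<open>p\<close>.\<close>

lemma fact_Lcm_mult_coeff_A_poly:
  assumes "k \<in> {1..n}"
  shows "of_nat (fact n * Lcm {1..n}) * coeff (A_poly n) (k - 1)
    = of_nat ((n choose k) * (\<Sum>i\<in>{n - k<..n}. Lcm {1..n} div i))"
proof -
  have "of_nat (fact n * Lcm {1..n}) * coeff (A_poly n) (k - 1)
      = of_nat (n choose k) * (of_nat (Lcm {1..n}) * (harmonic n - harmonic (n - k)))"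
    using assms by (auto simp: coeff_A_poly)
  then show ?thesis using assms by (simp only: of_nat_mult Lcm_mult_harmonic_diff atLeastAtMost_iff)
qed

lemma alpha_dvd: "alpha n dvd int (fact n * Lcm {1..n})"
  unfolding alpha_def coeff_denom_lcm_dvd_iff
proof
  fix i
  show "of_int (int (fact n * Lcm {1..n})) * coeff (A_poly n) i \<in> \<int>"
  proof (cases "i < n")
    case True
    then show ?thesis
      using fact_Lcm_mult_coeff_A_poly[of "Suc i" n]
      by (simp only: of_int_of_nat_eq diff_Suc_1) (simp del: of_nat_mult of_nat_sum)
  qed (simp add: coeff_A_poly)
qed

lemma dvd_alpha:
  assumes "n \<ge> 1"
  shows "int (fact n * Lcm {1..n}) dvd alpha n"
proof -
  define N where "N = fact n * Lcm {1..n}"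
  define D where "D = nat \<bar>alpha n\<bar>"
  have "Lcm {1..n} \<noteq> 0" by (subst Lcm_0_iff) auto
  then have "N > 0" unfolding N_def by (intro mult_pos_pos) (simp_all only: fact_gt_zero neq0_conv)
  have int: "of_nat D * coeff (A_poly n) i \<in> \<int>" for i
  proof -
    have "alpha n dvd int D" by (simp add: D_def)
    then show ?thesis unfolding alpha_def coeff_denom_lcm_dvd_iff by simp
  qed
  have "D > 0" using alpha_dvd[of n] \<open>N > 0\<close> by (auto simp: D_def N_def)
  have "N dvd D"
  proof (rule multiplicity_le_imp_dvd)
    fix p :: nat
    assume p: "prime p"
    \<comment> \<open>For \<open>p > n\<close> this gives \<open>e = 0\<close>, and the constant
      coefficient is used.\<close>
    obtain e where e: "p ^ e \<le> n" "n < p ^ Suc e"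
      using ex_power_ivl1[of p n] prime_ge_2_nat[OF p] assms by auto
    define C where "C = (n choose p ^ e)"
    define S where "S = (\<Sum>i\<in>{n - p ^ e<..n}. Lcm {1..n} div i)"
    have pos: "p ^ e > 0" using p by (simp add: prime_gt_0_nat)
    \<comment> \<open>This quotient is the leading base-\<open>p\<close> digit of \<open>n\<close>,
      hence nonzero modulo \<open>p\<close>.\<close>
    have "n div p ^ e > 0" "n div p ^ e < p"
      using e pos by (simp_all add: div_greater_zero_iff less_mult_imp_div_less)
    then have "\<not> p dvd C"
      using choose_prime_power_mod[OF p, of n e] by (auto simp: C_def dvd_eq_mod_eq_0)
    moreover have "\<not> p dvd S" unfolding S_def by (rule not_dvd_sum_Lcm_div[OF p e])
    ultimately have "\<not> p dvd C * S" using p by (simp add: prime_dvd_mult_iff)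
    then have cop: "coprime (p ^ multiplicity p N) (C * S)"
      using p by (simp add: prime_imp_coprime del: coprime_mult_right_iff)
    obtain z where z: "of_nat D * coeff (A_poly n) (p ^ e - 1) = of_int z"
      using int by (auto elim: Ints_cases)
    have "of_nat N * coeff (A_poly n) (p ^ e - 1) = of_nat (C * S)"
      unfolding N_def C_def S_def using e pos by (intro fact_Lcm_mult_coeff_A_poly) auto
    \<comment> \<open>Multiplying by the integer \<open>z\<close> shows that \<open>N\<close>
      divides \<open>D * (C * S)\<close>; as \<open>C * S\<close> is prime to \<open>p\<close>, the
      \<open>p\<close>-part of \<open>N\<close> must divide \<open>D\<close>.\<close>
    then have "of_nat (D * (C * S)) = of_nat N * (of_nat D * coeff (A_poly n) (p ^ e - 1))"
      by (simp add: mult_ac)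
    then have "of_int (int (D * (C * S))) = (of_int (int N * z) :: rat)"
      unfolding z by simp
    then have "int (D * (C * S)) = int N * z" by (simp only: of_int_eq_iff)
    then have "N dvd D * (C * S)" by (metis dvd_triv_left int_dvd_int_iff)
    then have "p ^ multiplicity p N dvd D * (C * S)"
      using multiplicity_dvd dvd_trans by blast
    then have "p ^ multiplicity p N dvd D"
      using cop by (simp add: coprime_dvd_mult_left_iff)
    then show "multiplicity p N \<le> multiplicity p D"
      using \<open>D > 0\<close> p by (intro multiplicity_geI) auto
  qed (use \<open>N > 0\<close> \<open>D > 0\<close> in auto)
  then show ?thesis by (simp add: N_def D_def)
qed

theorem theorem3p1:
  fixes n :: nat
  assumes "n \<ge> 1"
  shows "alpha n = fact n * Lcm {1..int n}"
proof -
  have "alpha n = int (fact n * Lcm {1..n})"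
    \<comment> \<open>Mutual divisibility gives equality because an integer \<open>Lcm\<close> is
      nonnegative.\<close>
    using alpha_dvd dvd_alpha[OF assms]
    by (intro zdvd_antisym_nonneg) (simp_all add: alpha_def coeff_denom_lcm_def)
  also have "int ` {1..n} = {1..int n}"
    by (simp add: image_int_atLeastAtMost)
  then have "int (fact n * Lcm {1..n}) = fact n * Lcm {1..int n}"
    by (metis Lcm_int_eq of_nat_fact of_nat_mult)
  finally show ?thesis .
qed

end
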